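(* Consider a system of $n>2$ oblivious fully synchronous robots without chirality, and let $C_0$ be an initial configuration. Then \textsc{Visit-All} is not solvable in $2$ steps from $C_0$ if one of the following holds: (i) $C_0\in\mathcal C_\odot$; (ii) there exists a symmetry axis of $C_0$ intersecting a proper non-empty subset of the points of $C_0$; (iii) there are at least two symmetry axes of $C_0$.
   Context: Model. There are $n>2$ robots $r_0,\dots,r_{n-1}$, which are points in $\mathbb R^2$. A configuration is a tuple $C=(p_0,\dots,p_{n-1})$ of points, $p_i$ being the position of $r_i$ in a fixed global coordinate system unknown to the robots; an initial configuration consists of pairwise distinct points. Each robot $r_i$ has a local Cartesian coordinate system $Z_i$, always centred at its current position, whose orientation and unit length are fixed over time but arbitrary and possibly different for different robots. No chirality: the handedness of the $Z_i$ is also arbitrary and may differ between robots. Robots are anonymous, oblivious and deterministic: an algorithm $\mathcal A$ is one function, the same for all robots, mapping a snapshot (the multiset of positions of all robots expressed in the observing robot's local coordinate system, its own position being the origin) to a destination point (in the same local coordinates). In each round all robots simultaneously take a snapshot, compute their destination, and move exactly to it. Thus $C_0$ and $Z=(Z_0,\dots,Z_{n-1})$ determine the run $(C_0,C_1,C_2,\dots)$ of $\mathcal A$. Permutations. For a permutation $\pi$ of $\{0,\dots,n-1\}$ put $\pi(C)=(p_{\pi(0)},\dots,p_{\pi(n-1)})$. $\Pi_n$ is the set of permutations that are a single $n$-cycle. Problem. For $k\ge 1$, $\mathcal A$ solves \textsc{Visit-All} in $k$ steps from $C_0$ if for every admissible $Z$ the run $(C_0,C_1,\dots)$ has the following property: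 for every $j\ge 0$ there is $\pi\in\Pi_n$ with $C_{j+ik}=\pi^i(C_j)$ for all $i\ge 0$. (As the robots are oblivious, every reached configuration $C_j$ counts as an initial configuration, from which the algorithm must also be correct.) The problem is solvable in $k$ steps from $C_0$ if some algorithm does this. $\mathcal C_\odot$ is the set of configurations $C$ having exactly one robot $r_c$ (the central robot) at the centre of the smallest circle enclosing $C$, and such that for some integer $k>1$ the rotation by $2\pi/k$ about the position of $r_c$ maps the multiset of points of $C$ to itself. A symmetry axis of $C_0$ is a line such that reflection in it maps the set of points of $C_0$ to itself.
   Formalization: In (iii) the points of C_0 are also assumed not to be collinear; otherwise the line through them counts as a symmetry axis and the claim fails, e.g. for four collinear points at -2, -1, 1, 2, where Visit-All is solvable in 2 steps. *)

theory Defs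
  imports "HOL-Analysis.Analysis" "HOL-Combinatorics.Permutations" "HOL-Combinatorics.Orbits"
begin

type_synonym point = "real^2"

(* The i-th entry is the global position of robot r_i. *)
type_synonym config = "point list"

(* A coordinate system is represented by the map from local coordinates to global displacements
   from the robot; u is the global length of the local unit.  Both signs of the determinant are
   allowed, i.e. there is no common chirality. *)
definition coord_system :: "(point \<Rightarrow> point) \<Rightarrow> bool" where
  "coord_system Z \<longleftrightarrow>
     (\<exists>u>0. \<exists>f. orthogonal_transformation f \<and> Z = (\<lambda>v. u *\<^sub>R f v))"

definition snapshot :: "(point \<Rightarrow> point) \<Rightarrow> point \<Rightarrow> config \<Rightarrow> point multiset" where
  "snapshot Z p C = image_mset (\<lambda>q. inv Z (q - p)) (mset C)"

type_synonym algorithm = "point multiset \<Rightarrow> point"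

definition step :: "algorithm \<Rightarrow> (nat \<Rightarrow> point \<Rightarrow> point) \<Rightarrow> config \<Rightarrow> config" where
  "step A Z C = map (\<lambda>i. C ! i + Z i (A (snapshot (Z i) (C ! i) C))) [0..<length C]"

definition run :: "algorithm \<Rightarrow> (nat \<Rightarrow> point \<Rightarrow> point) \<Rightarrow> config \<Rightarrow> nat \<Rightarrow> config" where
  "run A Z C j = (step A Z ^^ j) C"

definition n_cycles :: "nat \<Rightarrow> (nat \<Rightarrow> nat) set" where
  "n_cycles n = {\<pi>. \<pi> permutes {..<n} \<and> cyclic_on \<pi> {..<n}}"

definition solves_visit_all :: "algorithm \<Rightarrow> nat \<Rightarrow> config \<Rightarrow> bool" where
  "solves_visit_all A k C \<longleftrightarrow>
     (\<forall>Z. (\<forall>i<length C. coord_system (Z i)) \<longrightarrow>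
        (\<forall>j. \<exists>\<pi>\<in>n_cycles (length C). \<forall>i.
           run A Z C (j + i * k) = permute_list (\<pi> ^^ i) (run A Z C j)))"

definition visit_all_solvable :: "nat \<Rightarrow> config \<Rightarrow> bool" where
  "visit_all_solvable k C \<longleftrightarrow> (\<exists>A. solves_visit_all A k C)"

definition centre_smallest_enclosing :: "point \<Rightarrow> point set \<Rightarrow> bool" where
  "centre_smallest_enclosing c P \<longleftrightarrow>
     (\<exists>r. P \<subseteq> cball c r \<and> (\<forall>c' r'. P \<subseteq> cball c' r' \<longrightarrow> r \<le> r'))"

definition rotate_about :: "point \<Rightarrow> real \<Rightarrow> point \<Rightarrow> point" where
  "rotate_about c \<theta> p =
     c + vector [cos \<theta> * (p - c) $ 1 - sin \<theta> * (p - c) $ 2,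
                 sin \<theta> * (p - c) $ 1 + cos \<theta> * (p - c) $ 2]"

definition C_odot :: "config set" where
  "C_odot = {C. \<exists>c. centre_smallest_enclosing c (set C) \<and>
                    (\<exists>!i. i < length C \<and> C ! i = c) \<and>
                    (\<exists>k::nat. k > 1 \<and>
                       image_mset (rotate_about c (2 * pi / real k)) (mset C) = mset C)}"

(* closest_point L is the orthogonal projection onto the line L. *)
definition reflect_in :: "point set \<Rightarrow> point \<Rightarrow> point" where
  "reflect_in L p = 2 *\<^sub>R closest_point L p - p"

(* If P is collinear, the line through P is a symmetry axis of P, although its reflection fixes
   every point of P.  Hence a claim that two symmetry axes prevent Visit-All in 2 steps has to
   exclude collinear P: on four collinear points at -2, -1, 1, 2, which have two symmetry axes,
   moving alternately to -3, -1, 1, 3 (in this order) and back, composed with the 4-cycle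
   -2 |-> -1 |-> 2 |-> 1 |-> -2, is computable without chirality, since the 4-cycle commutes with
   negation. *)
definition symmetry_axis :: "point set \<Rightarrow> point set \<Rightarrow> bool" where
  "symmetry_axis L P \<longleftrightarrow> affine L \<and> aff_dim L = 1 \<and> reflect_in L ` P = P"

end

theory Submission
  imports Defs
begin

text \<open>
  The destination of a robot at \<open>p\<close> with coordinate system \<open>Z\<close> depends only on \<open>p\<close>, \<open>Z\<close> and the
  multiset of positions. For a fixed \<open>Z\<close> it is injective in \<open>p\<close>: if all robots use the same
  \<open>Z\<close>, two robots that meet never separate again. If all robots use \<open>Z\<close> except one that uses \<open>Z'\<close>,
  then after two steps the exceptional robot sits elsewhere, and since the first and the third
  configuration agree as multisets, injectivity forces the destinations under \<open>Z\<close> and \<open>Z'\<close> to agree.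
  So destinations do not depend on the coordinate systems at all, and hence commute with every
  congruence preserving the configuration. The same holds for the second step, so the \<open>n\<close>-cycle
  performed in two steps commutes with all symmetries of \<open>C\<^sub>0\<close>. A symmetry fixing one
  point then fixes all of them, which settles (i) and (ii). In (iii) we may thus assume that both
  reflections move all points; a cyclic group contains at most one involution, so they agree on
  the points, which are not collinear, and the axes coincide.
\<close>

section \<open>Destinations are independent of the coordinate systems\<close>

definition dest :: "algorithm \<Rightarrow> config \<Rightarrow> (point \<Rightarrow> point) \<Rightarrow> point \<Rightarrow> point" where
  "dest A C Z p = p + Z (A (snapshot Z p C))"

text \<open>\<open>T\<close> is an isometry of the plane with linear part \<open>g\<close>;
  orientation may be reversed. Naming \<open>g\<close> allows composing it with coordinate systems,
  which act on displacements.\<close>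

definition congruence :: "(point \<Rightarrow> point) \<Rightarrow> (point \<Rightarrow> point) \<Rightarrow> bool" where
  "congruence g T \<longleftrightarrow> orthogonal_transformation g \<and> (\<forall>p q. T q - T p = g (q - p))"

lemma dest_cong_mset: "mset C = mset C' \<Longrightarrow> dest A C Z p = dest A C' Z p"
  by (simp add: dest_def snapshot_def)

lemma length_step [simp]: "length (step A Z C) = length C"
  by (simp add: step_def)

lemma nth_step: "i < length C \<Longrightarrow> step A Z C ! i = dest A C (Z i) (C ! i)"
  by (simp add: step_def dest_def)

lemma run_0 [simp]: "run A Z C 0 = C"
  by (simp add: run_def)

lemma run_Suc: "run A Z C (Suc j) = step A Z (run A Z C j)"
  by (simp add: run_def)

lemma run_Suc': "run A Z C (Suc j) = run A Z (step A Z C) j"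
  by (simp add: run_def funpow_swap1)

lemma coord_system_id: "coord_system id"
  unfolding coord_system_def
  by (rule exI[of _ 1]) (auto intro!: exI[of _ id] simp: orthogonal_transformation_id id_def)

lemma coord_system_comp:
  assumes "orthogonal_transformation g" "coord_system Z"
  shows "coord_system (g \<circ> Z)"
proof -
  from assms(2) obtain u f where u: "u > 0" "orthogonal_transformation f" "Z = (\<lambda>v. u *\<^sub>R f v)"
    unfolding coord_system_def by blast
  have "linear g" using assms(1) by (rule orthogonal_transformation_linear)
  then have "g \<circ> Z = (\<lambda>v. u *\<^sub>R (g \<circ> f) v)"
    using u(3) by (auto simp: linear_scale)
  moreover have "orthogonal_transformation (g \<circ> f)"
    using assms(1) u(2) by (rule orthogonal_transformation_compose)
  ultimately show ?thesis unfolding coord_system_def using u(1) by blast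
qed

lemma bij_coord_system:
  assumes "coord_system Z" shows "bij Z"
proof -
  from assms obtain u f where u: "u > 0" "orthogonal_transformation f" "Z = (\<lambda>v. u *\<^sub>R f v)"
    unfolding coord_system_def by blast
  have "bij f" using u(2) by (rule orthogonal_transformation_bij)
  moreover have "bij (\<lambda>v::point. u *\<^sub>R v)"
    by (rule o_bij[of "\<lambda>v. (1/u) *\<^sub>R v"]) (use u(1) in \<open>auto simp: fun_eq_iff\<close>)
  ultimately have "bij ((\<lambda>v::point. u *\<^sub>R v) \<circ> f)" by (rule bij_comp)
  then show ?thesis by (simp add: u(3) comp_def)
qed

text \<open>As \<open>T\<close> preserves the multiset of positions, the observer at
  \<open>T p\<close> using \<open>g \<circ> Z\<close> sees the same snapshot as the observer at
  \<open>p\<close> using \<open>Z\<close>. The algorithm returns the same local vector, and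
  \<open>g\<close> transports the displacement.\<close>

lemma dest_congruence:
  assumes T: "congruence g T" and M: "image_mset T (mset C) = mset C" and Z: "coord_system Z"
  shows "dest A C (g \<circ> Z) (T p) = T (dest A C Z p)"
proof -
  have g: "orthogonal_transformation g" and Tg: "\<And>p q. T q - T p = g (q - p)"
    using T by (auto simp: congruence_def)
  have "bij g" using g by (rule orthogonal_transformation_bij)
  then have inv: "inv (g \<circ> Z) (g v) = inv Z v" for v
    using bij_coord_system[OF Z] by (simp add: o_inv_distrib bij_is_inj)
  have "snapshot (g \<circ> Z) (T p) C = image_mset (\<lambda>q. inv (g \<circ> Z) (q - T p)) (image_mset T (mset C))"
    by (simp add: snapshot_def M)
  also have "\<dots> = snapshot Z p C"
    by (simp add: snapshot_def multiset.map_comp comp_def Tg inv[unfolded comp_def])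
  finally show ?thesis
    using Tg[of "dest A C Z p" p] by (simp add: dest_def algebra_simps)
qed

lemma solves_visit_allD:
  assumes "solves_visit_all A 2 C" "\<And>i. i < length C \<Longrightarrow> coord_system (Z i)"
  obtains \<pi> where "\<pi> \<in> n_cycles (length C)"
    "\<And>i. run A Z C (j + i * 2) = permute_list (\<pi> ^^ i) (run A Z C j)"
  using assms unfolding solves_visit_all_def by blast

lemma n_cycles_moves:
  assumes "\<pi> \<in> n_cycles n" "n > 1" "i < n"
  shows "\<pi> i \<noteq> i"
proof
  assume fixed: "\<pi> i = i"
  have "cyclic_on \<pi> {..<n}" using assms(1) by (simp add: n_cycles_def)
  then have "orbit \<pi> i = {..<n}" using assms(3) by (metis lessThan_iff orbit_cyclic_eq3)
  moreover have "orbit \<pi> i = {i}" using fixed by (simp add: orbit_eq_singleton_iff)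
  ultimately have "card {..<n} = card {i}" by metis
  with assms(2) show False by simp
qed

lemma dest_inj_on:
  assumes S: "solves_visit_all A 2 C" and d: "distinct C" and Z: "coord_system Z"
  shows "inj_on (dest A C Z) (set C)"
proof (rule inj_onI)
  fix p q assume "p \<in> set C" "q \<in> set C" and eq: "dest A C Z p = dest A C Z q"
  then obtain a b where a: "a < length C" "p = C ! a" and b: "b < length C" "q = C ! b"
    by (metis in_set_conv_nth)
  obtain \<pi> where \<pi>: "\<pi> \<in> n_cycles (length C)"
    and P: "\<And>i. run A (\<lambda>_. Z) C (0 + i * 2) = permute_list (\<pi> ^^ i) (run A (\<lambda>_. Z) C 0)"
    using solves_visit_allD[OF S, of "\<lambda>_. Z" 0] Z by blast
  have 2: "step A (\<lambda>_. Z) (step A (\<lambda>_. Z) C) = permute_list \<pi> C"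
    using P[of 1] by (simp add: run_Suc numeral_2_eq_2)
  \<comment> \<open>Robots \<open>a\<close> and \<open>b\<close> meet after one round; with the
    common system \<open>Z\<close> they then have equal snapshots and stay together.\<close>
  have "step A (\<lambda>_. Z) (step A (\<lambda>_. Z) C) ! a = step A (\<lambda>_. Z) (step A (\<lambda>_. Z) C) ! b"
    using a b eq by (simp add: nth_step)
  moreover have "distinct (permute_list \<pi> C)"
    using \<pi> d by (simp add: n_cycles_def)
  ultimately have "a = b"
    using a b by (simp add: 2 nth_eq_iff_index_eq)
  then show "p = q" using a b by simp
qed

text \<open>One robot \<open>r\<close> uses \<open>Z'\<close>, all others use \<open>Z\<close>. The
  multisets reached after rounds one and three coincide, but the exceptional robot starts these
  rounds from different points. Comparing the two multisets forces two destinations under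
  \<open>Z'\<close> to coincide, against injectivity.\<close>

lemma dest_indep:
  assumes S: "solves_visit_all A 2 C" and d: "distinct C" and n: "length C > 1"
    and Z: "coord_system Z" and Z': "coord_system Z'" and p: "p \<in> set C"
  shows "dest A C Z' p = dest A C Z p"
proof (rule ccontr)
  assume neq: "dest A C Z' p \<noteq> dest A C Z p"
  define N where "N = length C"
  obtain r where r: "r < N" "p = C ! r"
    using p by (metis in_set_conv_nth N_def)
  define W where "W = (\<lambda>i. if i = r then Z' else Z)"
  have W: "coord_system (W i)" for i using Z Z' by (simp add: W_def)
  obtain \<pi> where \<pi>: "\<pi> \<in> n_cycles N"
    and P: "\<And>i. run A W C (0 + i * 2) = permute_list (\<pi> ^^ i) (run A W C 0)"
    using solves_visit_allD[OF S, of W 0] W unfolding N_def by blast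
  \<comment> \<open>Starting at \<open>j = 1\<close> relates the configurations after rounds one and
    three.\<close>
  obtain \<rho> where \<rho>: "\<rho> \<in> n_cycles N"
    and Q: "\<And>i. run A W C (1 + i * 2) = permute_list (\<rho> ^^ i) (run A W C 1)"
    using solves_visit_allD[OF S, of W 1] W unfolding N_def by blast
  have perm: "\<pi> permutes {..<N}" "\<rho> permutes {..<N}"
    using \<pi> \<rho> by (auto simp: n_cycles_def)
  define C1 where "C1 = step A W C"
  define C2 where "C2 = step A W C1"
  have C2: "C2 = permute_list \<pi> C"
    using P[of 1] by (simp add: run_Suc numeral_2_eq_2 C1_def C2_def)
  have C3: "step A W C2 = permute_list \<rho> C1"
    using Q[of 1] by (simp add: run_Suc eval_nat_numeral C1_def C2_def)
  have len: "length C1 = N" "length C2 = N" by (simp_all add: C1_def C2_def N_def)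
  have m2: "mset C2 = mset C" using perm by (simp add: C2 N_def)
  have m3: "mset (step A W C2) = mset C1" using perm by (simp add: C3 len)
  have \<pi>N: "\<pi> i < N" if "i < N" for i using perm(1) that by (metis lessThan_iff permutes_in_image)
  let ?f = "dest A C"
  have as_image: "mset xs = image_mset (\<lambda>i. xs ! i) (mset_set {..<N})"
    if "length xs = N" for xs :: config
    using that by (metis map_nth mset_map mset_upt atLeast0LessThan)
  have split: "mset_set {..<N} = add_mset r (mset_set ({..<N} - {r}))"
    using r by (simp add: mset_set.remove)
  let ?F = "image_mset (\<lambda>i. ?f Z (C ! i)) (mset_set {..<N})"
  let ?G = "image_mset (\<lambda>i. ?f Z (C ! \<pi> i)) (mset_set {..<N})"
  have rest: "image_mset (\<lambda>i. ?f (W i) (h i)) (mset_set ({..<N} - {r}))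
      = image_mset (\<lambda>i. ?f Z (h i)) (mset_set ({..<N} - {r}))" for h
    by (rule image_mset_cong) (auto simp: W_def)
  \<comment> \<open>Relative to \<open>?F\<close>, where everybody uses \<open>Z\<close>, just the
    element of robot \<open>r\<close> is exchanged. The exchange is written with
    \<open>add_mset\<close> on both sides to avoid multiset subtraction.\<close>
  have "mset C1 = image_mset (\<lambda>i. ?f (W i) (C ! i)) (mset_set {..<N})"
    unfolding as_image[OF len(1)]
    by (rule image_mset_cong) (auto simp: C1_def nth_step N_def)
  then have 1: "add_mset (?f Z (C ! r)) (mset C1) = add_mset (?f Z' (C ! r)) ?F"
    by (simp add: split rest) (simp add: W_def)
  \<comment> \<open>Robot \<open>r\<close> now starts from \<open>C ! \<pi> r\<close>, so the
    exchanged element belongs to that point.\<close>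
  have "mset (step A W C2) = image_mset (\<lambda>i. ?f (W i) (C ! \<pi> i)) (mset_set {..<N})"
    unfolding as_image[OF trans[OF length_step len(2)]]
    using perm(1) dest_cong_mset[OF m2]
    by (intro image_mset_cong) (auto simp: nth_step len C2 N_def permute_list_nth)
  then have 2: "add_mset (?f Z (C ! \<pi> r)) (mset C1) = add_mset (?f Z' (C ! \<pi> r)) ?G"
    unfolding m3 by (simp add: split rest) (simp add: W_def)
  have "?G = image_mset (\<lambda>i. ?f Z (C ! i)) (image_mset \<pi> (mset_set {..<N}))"
    by (simp add: multiset.map_comp comp_def)
  also have "image_mset \<pi> (mset_set {..<N}) = mset_set {..<N}"
    using perm(1) by (simp add: image_mset_mset_set permutes_inj_on permutes_image)
  finally have FG: "?G = ?F" .
  have "?F + {#?f Z (C ! \<pi> r), ?f Z' (C ! r)#} = add_mset (?f Z (C ! \<pi> r)) (add_mset (?f Z (C ! r)) (mset C1))"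
    unfolding 1 by simp
  also have "\<dots> = add_mset (?f Z (C ! r)) (add_mset (?f Z (C ! \<pi> r)) (mset C1))"
    by (rule add_mset_commute)
  also have "\<dots> = ?F + {#?f Z (C ! r), ?f Z' (C ! \<pi> r)#}"
    unfolding 2 FG by simp
  finally have "{#?f Z (C ! \<pi> r), ?f Z' (C ! r)#} = {#?f Z (C ! r), ?f Z' (C ! \<pi> r)#}"
    by (rule add_left_imp_eq)
  \<comment> \<open>The left member \<open>?f Z' (C ! r)\<close> must occur on the right, where
    \<open>neq\<close> rules out \<open>?f Z (C ! r)\<close>.\<close>
  then have "?f Z' (C ! r) = ?f Z' (C ! \<pi> r)"
    using neq r(2) by (auto simp: add_eq_conv_ex)
  then have "C ! r = C ! \<pi> r"
    using dest_inj_on[OF S d Z'] r \<pi>N unfolding N_def by (meson inj_onD nth_mem)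
  then have "\<pi> r = r"
    using d r \<pi>N unfolding N_def by (simp add: nth_eq_iff_index_eq)
  then show False using n_cycles_moves[OF \<pi>] n r by (simp add: N_def)
qed

section \<open>Equivariance under the symmetries of the configuration\<close>

text \<open>\<open>dest_congruence\<close> changes the system from \<open>id\<close> to
  \<open>g \<circ> id\<close>; independence undoes this change.\<close>

lemma dest_commutes:
  assumes "solves_visit_all A 2 C" "distinct C" "length C > 1"
    and T: "congruence g T" and M: "image_mset T (mset C) = mset C" and p: "p \<in> set C"
  shows "dest A C id (T p) = T (dest A C id p)"
proof -
  have "T p \<in> set C"
    using M p by (metis image_eqI set_image_mset set_mset_mset)
  then have "dest A C id (T p) = dest A C (g \<circ> id) (T p)"
    using assms coord_system_id coord_system_comp[OF _ coord_system_id, of g]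
    by (intro dest_indep) (auto simp: congruence_def)
  then show ?thesis using dest_congruence[OF T M coord_system_id] by simp
qed

text \<open>A round becomes the application of one map to all positions; \<open>id\<close> merely
  represents an arbitrary coordinate system.\<close>

lemma step_eq_map_dest:
  assumes "solves_visit_all A 2 C" "distinct C" "length C > 1"
    and "\<And>i. i < length C \<Longrightarrow> coord_system (Z i)"
  shows "step A Z C = map (dest A C id) C"
  by (rule nth_equalityI) (use assms in \<open>auto simp: nth_step intro!: dest_indep coord_system_id\<close>)

text \<open>The first round gives the same configuration for every \<open>Z\<close>, so each run
  from there is the tail of a run from \<open>C\<close> with the same \<open>Z\<close>.\<close>

lemma solves_after_step:
  assumes S: "solves_visit_all A 2 C" and d: "distinct C" and n: "length C > 1"
  shows "solves_visit_all A 2 (map (dest A C id) C)"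
  unfolding solves_visit_all_def
proof (intro allI impI)
  fix Z j assume Z: "\<forall>i<length (map (dest A C id) C). coord_system (Z i)"
  then have "step A Z C = map (dest A C id) C"
    using step_eq_map_dest[OF S d n] by simp
  then have run: "run A Z (map (dest A C id) C) k = run A Z C (Suc k)" for k
    by (simp add: run_Suc')
  obtain \<pi> where "\<pi> \<in> n_cycles (length C)"
    "\<And>i. run A Z C (Suc j + i * 2) = permute_list (\<pi> ^^ i) (run A Z C (Suc j))"
    using solves_visit_allD[OF S, of Z "Suc j"] Z by auto
  then show "\<exists>\<pi>\<in>n_cycles (length (map (dest A C id) C)). \<forall>i.
      run A Z (map (dest A C id) C) (j + i * 2)
      = permute_list (\<pi> ^^ i) (run A Z (map (dest A C id) C) j)"
    by (auto simp: run)
qed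

text \<open>\<open>H\<close> is the two-round map on positions. On \<open>set C\<close> it is the
  \<open>n\<close>-cycle performed by the robots, hence transitive, and it commutes there with every
  symmetry because each of the two rounds does.\<close>

lemma symmetric_cycle:
  assumes S: "solves_visit_all A 2 C" and d: "distinct C" and n: "length C > 1"
  obtains H where
    "\<And>p q. p \<in> set C \<Longrightarrow> q \<in> set C \<Longrightarrow> \<exists>m. q = (H ^^ m) p"
    "\<And>p m. p \<in> set C \<Longrightarrow> (H ^^ m) p \<in> set C"
    "\<And>g T p m. congruence g T \<Longrightarrow> image_mset T (mset C) = mset C \<Longrightarrow> p \<in> set C \<Longrightarrow>
       (H ^^ m) (T p) = T ((H ^^ m) p)"
proof -
  define F where "F = dest A C id"
  define C1 where "C1 = map F C"
  define G where "G = dest A C1 id"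
  define H where "H = G \<circ> F"
  have S1: "solves_visit_all A 2 C1"
    using solves_after_step[OF assms] by (simp add: C1_def F_def)
  have d1: "distinct C1"
    using d dest_inj_on[OF S d coord_system_id] by (simp add: C1_def F_def distinct_map)
  have n1: "length C1 > 1" using n by (simp add: C1_def)
  obtain \<pi> where \<pi>: "\<pi> \<in> n_cycles (length C)"
    and P: "\<And>i. run A (\<lambda>_. id) C (0 + i * 2) = permute_list (\<pi> ^^ i) (run A (\<lambda>_. id) C 0)"
    using solves_visit_allD[OF S, of "\<lambda>_. id" 0] coord_system_id by blast
  have "step A (\<lambda>_. id) C = C1"
    using step_eq_map_dest[OF S d n] coord_system_id by (simp add: C1_def F_def)
  moreover have "step A (\<lambda>_. id) C1 = map G C1"
    using step_eq_map_dest[OF S1 d1 n1] coord_system_id by (simp add: G_def)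
  ultimately have HC: "map H C = permute_list \<pi> C"
    using P[of 1] by (simp add: run_Suc numeral_2_eq_2 H_def C1_def)
  have perm: "\<pi> permutes {..<length C}" and cyc: "cyclic_on \<pi> {..<length C}"
    using \<pi> by (auto simp: n_cycles_def)
  have H1: "H (C ! i) = C ! \<pi> i" if "i < length C" for i
    using arg_cong[OF HC, of "\<lambda>xs. xs ! i"] that perm by (simp add: permute_list_nth)
  have \<pi>m: "(\<pi> ^^ m) i < length C" if "i < length C" for i m
    using that permutes_in_image[OF perm] by (induction m) auto
  have Hm: "(H ^^ m) (C ! i) = C ! (\<pi> ^^ m) i" if "i < length C" for i m
    using that by (induction m) (auto simp: H1 \<pi>m)
  show thesis
  proof (rule that)
    fix p q assume "p \<in> set C" "q \<in> set C"
    then obtain a b where a: "a < length C" "p = C ! a" and b: "b < length C" "q = C ! b"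
      by (metis in_set_conv_nth)
    have "orbit \<pi> a = {..<length C}"
      using cyc a(1) by (metis lessThan_iff orbit_cyclic_eq3)
    then obtain m where "b = (\<pi> ^^ m) a" using b(1) by (auto simp: orbit_altdef)
    then show "\<exists>m. q = (H ^^ m) p" using Hm[of a m] a b by metis
  next
    fix p m assume "p \<in> set C"
    then obtain a where "a < length C" "p = C ! a" by (metis in_set_conv_nth)
    then show "(H ^^ m) p \<in> set C" by (simp add: Hm \<pi>m)
  next
    fix g T p m
    assume T: "congruence g T" and M: "image_mset T (mset C) = mset C" and p: "p \<in> set C"
    have F: "F (T x) = T (F x)" if "x \<in> set C" for x
      using dest_commutes[OF S d n T M that] by (simp add: F_def)
    \<comment> \<open>The intermediate configuration inherits the symmetry \<open>T\<close>, so
      equivariance applies to the second round as well.\<close>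
    have "image_mset T (mset C1) = image_mset (T \<circ> F) (mset C)"
      by (simp add: C1_def multiset.map_comp)
    also have "\<dots> = image_mset (F \<circ> T) (mset C)"
      by (rule image_mset_cong) (simp add: F)
    also have "\<dots> = mset C1"
      by (metis M C1_def mset_map multiset.map_comp)
    finally have M1: "image_mset T (mset C1) = mset C1" .
    have HT: "H (T x) = T (H x)" if "x \<in> set C" for x
      using dest_commutes[OF S1 d1 n1 T M1, of "F x"] that by (simp add: H_def F G_def C1_def)
    have "(H ^^ m) x \<in> set C" if "x \<in> set C" for x m
      using that Hm \<pi>m by (metis in_set_conv_nth)
    with p show "(H ^^ m) (T p) = T ((H ^^ m) p)"
      by (induction m) (auto simp: HT)
  qed
qed

section \<open>Reflections and rotations\<close>

lemma congruence_about:
  assumes "orthogonal_transformation g"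
  shows "congruence g (\<lambda>p. c + g (p - c))"
proof -
  have "linear g" using assms by (rule orthogonal_transformation_linear)
  then show ?thesis using assms
    by (auto simp: congruence_def linear_diff[symmetric])
qed

lemma congruence_inj:
  assumes "congruence g T"
  shows "inj T"
proof (rule injI)
  fix p q assume "T p = T q"
  then have "g (p - q) = 0" using assms by (metis congruence_def diff_self)
  then show "p = q"
    using assms orthogonal_transformation_norm[of g "p - q"] by (simp add: congruence_def)
qed

text \<open>Congruences are affine maps. This extends agreement of two reflections from the robots
  to their affine hull.\<close>

lemma congruence_eq_affine:
  assumes "congruence g T" "congruence h U"
  shows "affine {x. T x = U x}"
proof -
  have aff: "T (u *\<^sub>R x + v *\<^sub>R y) = u *\<^sub>R T x + v *\<^sub>R T y"
    if T: "congruence g T" and uv: "u + v = 1" for g T u v x y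
  proof -
    have lin: "linear g" and Tg: "T z - T 0 = g z" for z
      using T by (auto simp: congruence_def orthogonal_transformation_linear)
    have "T (u *\<^sub>R x + v *\<^sub>R y) = (u + v) *\<^sub>R T 0 + (u *\<^sub>R g x + v *\<^sub>R g y)"
      using Tg[of "u *\<^sub>R x + v *\<^sub>R y"] uv by (simp add: linear_add[OF lin] linear_scale[OF lin] algebra_simps)
    then show ?thesis unfolding Tg[symmetric] by (simp add: algebra_simps)
  qed
  then show ?thesis
    using aff[OF assms(1)] aff[OF assms(2)] by (auto simp: affine_def)
qed

lemma reflect_in_line:
  assumes "affine L" "aff_dim L = 1"
  obtains g where "congruence g (reflect_in L)" "\<And>p. reflect_in L (reflect_in L p) = p"
    "\<And>p. reflect_in L p = p \<longleftrightarrow> p \<in> L"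
proof -
  obtain B where B: "\<not> affine_dependent B" "affine hull B = L" "of_nat (card B) = aff_dim L + 1"
    using aff_dim_inner_basis_exists[of L] assms(1) by (metis affine_hull_eq)
  then have "card B = 2" using assms(2) by simp
  then obtain a b where ab: "a \<noteq> b" "B = {a, b}" by (auto simp: card_2_iff)
  define u where "u = (1 / norm (b - a)) *\<^sub>R (b - a)"
  have uu: "u \<bullet> u = 1" using ab(1) by (simp add: u_def dot_square_norm power2_eq_square)
  have ba: "b - a = norm (b - a) *\<^sub>R u" using ab(1) by (simp add: u_def)
  have L: "L = range (\<lambda>t. a + t *\<^sub>R u)"
  proof -
    have "L = range (\<lambda>t. a + t *\<^sub>R (b - a))"
      using B(2) ab(2) by (simp add: affine_hull_2_alt)
    also have "\<dots> = range (\<lambda>t. a + t *\<^sub>R u)"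
    proof (intro equalityI subsetI)
      fix x assume "x \<in> range (\<lambda>t. a + t *\<^sub>R (b - a))"
      then obtain t where "x = a + t *\<^sub>R (b - a)" by blast
      then have "x = a + (t * norm (b - a)) *\<^sub>R u" by (subst (asm) ba) simp
      then show "x \<in> range (\<lambda>t. a + t *\<^sub>R u)" by blast
    next
      fix x assume "x \<in> range (\<lambda>t. a + t *\<^sub>R u)"
      then obtain t where "x = a + t *\<^sub>R u" by blast
      then have "x = a + (t / norm (b - a)) *\<^sub>R (b - a)" by (simp add: u_def)
      then show "x \<in> range (\<lambda>t. a + t *\<^sub>R (b - a))" by blast
    qed
    finally show ?thesis .
  qed
  \<comment> \<open>The linear part of the reflection: it keeps the component along the unit
    direction \<open>u\<close> of \<open>L\<close> and negates the orthogonal one.\<close>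
  define g where "g = (\<lambda>v. (2 * (v \<bullet> u)) *\<^sub>R u - v)"
  have proj: "closest_point L x = a + ((x - a) \<bullet> u) *\<^sub>R u" for x
  proof (rule sym, rule closest_point_unique)
    show "convex L" using assms(1) by (rule affine_imp_convex)
    show "closed L" using assms(1) by (metis affine_hull_eq closed_affine_hull)
    show "a + ((x - a) \<bullet> u) *\<^sub>R u \<in> L" by (auto simp: L)
    show "\<forall>z\<in>L. dist x (a + ((x - a) \<bullet> u) *\<^sub>R u) \<le> dist x z"
    proof
      fix z assume "z \<in> L"
      then obtain t where z: "z = a + t *\<^sub>R u" by (auto simp: L)
      \<comment> \<open>\<open>x - z\<close> splits into \<open>w\<close>, orthogonal to
        \<open>L\<close>, and a vector along \<open>L\<close>; by Pythagoras it is at least as long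
        as \<open>w\<close>.\<close>
      define s where "s = (x - a) \<bullet> u"
      define w where "w = x - (a + s *\<^sub>R u)"
      have "w \<bullet> u = 0" using uu by (simp add: w_def s_def inner_diff_left inner_add_left)
      then have "orthogonal w ((s - t) *\<^sub>R u)" by (simp add: orthogonal_def)
      then have "(norm w)\<^sup>2 \<le> (norm (w + (s - t) *\<^sub>R u))\<^sup>2"
        by (simp add: norm_add_Pythagorean)
      moreover have "w + (s - t) *\<^sub>R u = x - z" by (simp add: w_def z algebra_simps)
      ultimately have "norm w \<le> norm (x - z)" by simp
      then show "dist x (a + ((x - a) \<bullet> u) *\<^sub>R u) \<le> dist x z"
        by (simp add: dist_norm w_def s_def)
    qed
  qed
  have R: "reflect_in L x = a + g (x - a)" for x
    by (simp add: reflect_in_def proj g_def algebra_simps scaleR_2)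
  have "linear g"
    unfolding g_def by (rule linearI) (simp_all add: inner_add_left algebra_simps)
  moreover have "g v \<bullet> g w = v \<bullet> w" for v w
    using uu by (simp add: g_def inner_diff_left inner_diff_right inner_commute algebra_simps)
  ultimately have g: "orthogonal_transformation g"
    by (simp add: orthogonal_transformation_def)
  have gg: "g (g v) = v" for v
    using uu by (simp add: g_def inner_diff_left algebra_simps)
  show thesis
  proof (rule that)
    show "congruence g (reflect_in L)"
      using congruence_about[OF g, of a] by (simp add: R[abs_def])
    show "reflect_in L (reflect_in L p) = p" for p by (simp add: R gg)
    show "reflect_in L p = p \<longleftrightarrow> p \<in> L" for p
    proof
      assume "reflect_in L p = p"
      then have "2 *\<^sub>R closest_point L p = 2 *\<^sub>R p"
        by (simp add: reflect_in_def scaleR_2 algebra_simps)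
      then have "p = a + ((p - a) \<bullet> u) *\<^sub>R u" by (simp add: proj)
      then show "p \<in> L" unfolding L by (rule range_eqI)
    next
      assume "p \<in> L"
      then show "reflect_in L p = p"
        by (simp add: reflect_in_def closest_point_self scaleR_2)
    qed
  qed
qed

lemma symmetry_axis_mset:
  assumes "symmetry_axis L (set C)" "distinct C"
  shows "image_mset (reflect_in L) (mset C) = mset C"
proof -
  obtain g where "congruence g (reflect_in L)"
    using reflect_in_line assms(1) unfolding symmetry_axis_def by metis
  then have "inj_on (reflect_in L) (set C)"
    using congruence_inj inj_on_subset by blast
  then have "image_mset (reflect_in L) (mset_set (set C)) = mset_set (reflect_in L ` set C)"
    by (rule image_mset_mset_set)
  then show ?thesis
    using assms by (simp add: symmetry_axis_def mset_set_set)
qed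

lemma rotate_about_congruence:
  obtains g where "congruence g (rotate_about c \<theta>)"
proof -
  define g :: "point \<Rightarrow> point"
    where "g = (\<lambda>v. vector [cos \<theta> * v $ 1 - sin \<theta> * v $ 2, sin \<theta> * v $ 1 + cos \<theta> * v $ 2])"
  have "linear g"
    unfolding g_def
    by (rule linearI) (simp_all add: vec_eq_iff forall_2 vector_2 algebra_simps)
  moreover have "g v \<bullet> g w = v \<bullet> w" for v w
  proof -
    have "g v \<bullet> g w = ((sin \<theta>)\<^sup>2 + (cos \<theta>)\<^sup>2) * (v $ 1 * w $ 1) + ((sin \<theta>)\<^sup>2 + (cos \<theta>)\<^sup>2) * (v $ 2 * w $ 2)"
      unfolding g_def
      by (simp add: inner_vec_def sum_2 vector_2 power2_eq_square algebra_simps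
          del: sin_cos_squared_add sin_cos_squared_add2 sin_cos_squared_add3)
    then show ?thesis by (simp add: inner_vec_def sum_2)
  qed
  ultimately have "orthogonal_transformation g"
    by (simp add: orthogonal_transformation_def)
  from congruence_about[OF this, of c] show thesis
    using that by (simp add: rotate_about_def[abs_def] g_def)
qed

lemma rotate_about_fixed:
  assumes "k > 1" "rotate_about c (2 * pi / real k) p = p"
  shows "p = c"
proof -
  define \<theta> where "\<theta> = 2 * pi / real k"
  define x y where "x = (p - c) $ 1" and "y = (p - c) $ 2"
  have "vector [cos \<theta> * x - sin \<theta> * y, sin \<theta> * x + cos \<theta> * y] = p - c"
    using assms(2) unfolding rotate_about_def \<theta>_def x_def y_def by (metis add_diff_cancel_left')
  then have e: "cos \<theta> * x - sin \<theta> * y = x" "sin \<theta> * x + cos \<theta> * y = y"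
    unfolding x_def y_def by (metis vector_2)+
  have "cos \<theta> \<noteq> 1"
  proof
    assume "cos \<theta> = 1"
    then obtain m :: int where "\<theta> = real_of_int m * 2 * pi" using cos_one_2pi_int by blast
    then have "real_of_int (m * int k) = 1" using assms(1) by (simp add: \<theta>_def field_simps)
    then have "m * int k = 1" by linarith
    then show False using assms(1) by (simp add: zmult_eq_1_iff)
  qed
  \<comment> \<open>This is the determinant of the rotation minus the identity. The two identities
    below multiply by the adjugate, so a fixed displacement must vanish.\<close>
  then have c: "(1 - cos \<theta>)\<^sup>2 + (sin \<theta>)\<^sup>2 > 0" by (simp add: add_pos_nonneg)
  have "((1 - cos \<theta>)\<^sup>2 + (sin \<theta>)\<^sup>2) * x
      = (1 - cos \<theta>) * (x - (cos \<theta> * x - sin \<theta> * y)) + sin \<theta> * (sin \<theta> * x + cos \<theta> * y - y)"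
    by (simp add: power2_eq_square algebra_simps del: sin_cos_squared_add3)
  then have "((1 - cos \<theta>)\<^sup>2 + (sin \<theta>)\<^sup>2) * x = 0" unfolding e by simp
  moreover have "((1 - cos \<theta>)\<^sup>2 + (sin \<theta>)\<^sup>2) * y
      = (1 - cos \<theta>) * (y - (sin \<theta> * x + cos \<theta> * y)) + sin \<theta> * (x - (cos \<theta> * x - sin \<theta> * y))"
    by (simp add: power2_eq_square algebra_simps del: sin_cos_squared_add3)
  then have "((1 - cos \<theta>)\<^sup>2 + (sin \<theta>)\<^sup>2) * y = 0" unfolding e by simp
  ultimately have "x = 0" "y = 0" using c by auto
  then show ?thesis by (simp add: x_def y_def vec_eq_iff forall_2)
qed

section \<open>Impossibility\<close>

text \<open>Writing \<open>q = (H ^^ m) p\<close> gives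
  \<open>T q = (H ^^ m) (T p) = (H ^^ m) p = q\<close>.\<close>

lemma symmetry_fixes_all:
  assumes "solves_visit_all A 2 C" "distinct C" "length C > 1"
    and "congruence g T" "image_mset T (mset C) = mset C"
    and "p \<in> set C" "T p = p" "q \<in> set C"
  shows "T q = q"
proof -
  obtain H where
    "\<And>p q. p \<in> set C \<Longrightarrow> q \<in> set C \<Longrightarrow> \<exists>m. q = (H ^^ m) p" and
    "\<And>g T p m. congruence g T \<Longrightarrow> image_mset T (mset C) = mset C \<Longrightarrow> p \<in> set C \<Longrightarrow>
       (H ^^ m) (T p) = T ((H ^^ m) p)"
    using symmetric_cycle[OF assms(1-3)] by metis
  then show ?thesis using assms by metis
qed

text \<open>A map commuting with the cycle is determined by its value at \<open>p\<close>, which is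
  some power of \<open>H\<close> applied to \<open>p\<close>. For an involution moving
  \<open>p\<close> this exponent is half the period of \<open>p\<close>, modulo the period.\<close>

lemma cycle_involution_unique:
  assumes cyc: "\<And>q. q \<in> S \<Longrightarrow> \<exists>m. q = (H ^^ m) p"
    and H: "\<And>m. (H ^^ m) p \<in> S" and p: "p \<in> S"
    and T: "\<And>m q. q \<in> S \<Longrightarrow> (H ^^ m) (T q) = T ((H ^^ m) q)" "T p \<in> S" "T (T p) = p" "T p \<noteq> p"
    and U: "\<And>m q. q \<in> S \<Longrightarrow> (H ^^ m) (U q) = U ((H ^^ m) q)" "U p \<in> S" "U (U p) = p" "U p \<noteq> p"
    and q: "q \<in> S"
  shows "T q = U q"
proof -
  \<comment> \<open>The minimality of \<open>d\<close> is part of the claim, so that the instances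
    for \<open>T\<close> and \<open>U\<close> yield the same period.\<close>
  have half: "\<exists>a d. 0 < d \<and> (H ^^ d) p = p \<and> (\<forall>e. 0 < e \<and> (H ^^ e) p = p \<longrightarrow> d \<le> e) \<and>
      2 * a = d \<and> V p = (H ^^ a) p"
    if V: "\<And>m q. q \<in> S \<Longrightarrow> (H ^^ m) (V q) = V ((H ^^ m) q)" "V p \<in> S" "V (V p) = p" "V p \<noteq> p"
    for V
  proof -
    obtain b where b: "V p = (H ^^ b) p" using cyc V(2) by blast
    \<comment> \<open>\<open>(H ^^ b') ((H ^^ b') p) = (H ^^ b') (V p) = V ((H ^^ b') p) = V (V p) =
      p\<close>.\<close>
    have twice: "(H ^^ (2 * b')) p = p" if "V p = (H ^^ b') p" for b'
      using that V(1)[OF p, of b'] V(3) by (simp add: mult_2 funpow_add)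
    have "b > 0" using b V(4) by (cases b) auto
    define P where "P = (\<lambda>e. 0 < e \<and> (H ^^ e) p = p)"
    define d where "d = (LEAST e. P e)"
    have "P (2 * b)" using twice[OF b] \<open>b > 0\<close> by (simp add: P_def)
    then have Pd: "P d" unfolding d_def by (rule LeastI)
    have least: "d \<le> e" if "P e" for e unfolding d_def using that by (rule Least_le)
    have d: "0 < d" "(H ^^ d) p = p" using Pd by (auto simp: P_def)
    \<comment> \<open>Reduction modulo the period gives \<open>0 < a < d\<close>; as
      \<open>d\<close> divides \<open>2 * a\<close>, which is below \<open>2 * d\<close>, only
      \<open>2 * a = d\<close> remains.\<close>
    define a where "a = b mod d"
    have a: "V p = (H ^^ a) p" using b d(2) by (simp add: a_def funpow_mod_eq)
    have "a < d" using d by (simp add: a_def)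
    have "a > 0" using a V(4) by (cases a) auto
    have "(H ^^ ((2 * a) mod d)) p = p" using twice[OF a] d(2) by (simp add: funpow_mod_eq)
    moreover have "(2 * a) mod d < d" using d(1) by (rule mod_less_divisor)
    ultimately have "(2 * a) mod d = 0"
      using least[of "(2 * a) mod d"] unfolding P_def by linarith
    then have "d dvd 2 * a" by (rule mod_0_imp_dvd)
    then obtain k where k: "2 * a = d * k" by (rule dvdE)
    have "d * k < d * 2" using k \<open>a < d\<close> by linarith
    then have "k < 2" by simp
    moreover have "k \<noteq> 0" using k \<open>a > 0\<close> by (intro notI) simp
    ultimately have "k = 1" by linarith
    then have "2 * a = d" using k by simp
    then show ?thesis
      using d a least unfolding P_def by blast
  qed
  obtain a d where a: "0 < d" "(H ^^ d) p = p" "\<forall>e. 0 < e \<and> (H ^^ e) p = p \<longrightarrow> d \<le> e"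
      "2 * a = d" "T p = (H ^^ a) p"
    using half[OF T] by blast
  obtain a' d' where a': "0 < d'" "(H ^^ d') p = p" "\<forall>e. 0 < e \<and> (H ^^ e) p = p \<longrightarrow> d' \<le> e"
      "2 * a' = d'" "U p = (H ^^ a') p"
    using half[OF U] by blast
  have "d = d'"
  proof (rule le_antisym)
    show "d \<le> d'" using a(3) a'(1,2) by blast
    show "d' \<le> d" using a'(3) a(1,2) by blast
  qed
  then have "a = a'" using a(4) a'(4) by linarith
  then have "T p = U p" using a(5) a'(5) by simp
  moreover obtain m where "q = (H ^^ m) p" using cyc q by blast
  ultimately show ?thesis using T(1)[OF p, of m] U(1)[OF p, of m] by simp
qed

text \<open>The rotation fixes the central robot, so it would fix all robots, yet the centre is its
  only fixed point.\<close>

lemma rotation_unsolvable: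
  assumes C: "C \<in> C_odot" and d: "distinct C" and n: "length C > 1"
  shows "\<not> solves_visit_all A 2 C"
proof
  assume S: "solves_visit_all A 2 C"
  from C obtain c k where c: "c \<in> set C" and k: "k > 1"
    and M: "image_mset (rotate_about c (2 * pi / real k)) (mset C) = mset C"
    unfolding C_odot_def using nth_mem by blast
  obtain g where g: "congruence g (rotate_about c (2 * pi / real k))"
    by (rule rotate_about_congruence)
  have "rotate_about c (2 * pi / real k) c = c"
    by (simp add: rotate_about_def vec_eq_iff forall_2 vector_2)
  from symmetry_fixes_all[OF S d n g M c this] have "set C \<subseteq> {c}"
    using rotate_about_fixed[OF k] by blast
  then have "card (set C) \<le> 1" using card_mono[of "{c}" "set C"] by simp
  then show False using d n by (simp add: distinct_card)
qed

text \<open>The fixed points of the reflection are the points of \<open>L\<close>, so one robot on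
  \<open>L\<close> would force all of them onto \<open>L\<close>.\<close>

lemma axis_unsolvable:
  assumes L: "symmetry_axis L (set C)" and ne: "L \<inter> set C \<noteq> {}" and proper: "L \<inter> set C \<subset> set C"
    and d: "distinct C" and n: "length C > 1"
  shows "\<not> solves_visit_all A 2 C"
proof
  assume S: "solves_visit_all A 2 C"
  obtain g where g: "congruence g (reflect_in L)" and fixed: "\<And>p. reflect_in L p = p \<longleftrightarrow> p \<in> L"
    using reflect_in_line L unfolding symmetry_axis_def by metis
  obtain p where "p \<in> set C" "p \<in> L" using ne by blast
  then have "q \<in> L" if "q \<in> set C" for q
    using symmetry_fixes_all[OF S d n g symmetry_axis_mset[OF L d], of p] fixed that by blast
  then show False using proper by blast
qed

text \<open>Non-collinearity enters twice: no axis contains all robots, and the robots affinely span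
  the plane, so reflections that agree on them are equal.\<close>

lemma two_axes_unsolvable:
  assumes L1: "symmetry_axis L1 (set C)" and L2: "symmetry_axis L2 (set C)" and neq: "L1 \<noteq> L2"
    and nc: "\<not> collinear (set C)" and d: "distinct C" and n: "length C > 1"
  shows "\<not> solves_visit_all A 2 C"
proof
  assume S: "solves_visit_all A 2 C"
  have noncoll: "\<not> set C \<subseteq> L" if "symmetry_axis L (set C)" for L
  proof
    assume "set C \<subseteq> L"
    then have "aff_dim (set C) \<le> 1" using aff_dim_subset that by (metis symmetry_axis_def)
    then show False using nc by (simp add: collinear_aff_dim)
  qed
  \<comment> \<open>An axis meeting \<open>set C\<close> would meet it in a proper subset, which is
    the previous case; so both reflections move every robot.\<close>
  have disj: "p \<notin> L" if "symmetry_axis L (set C)" "p \<in> set C" for L p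
    using axis_unsolvable[OF that(1) _ _ d n] noncoll[OF that(1)] S that(2) by blast
  obtain g1 where g1: "congruence g1 (reflect_in L1)"
    and i1: "\<And>p. reflect_in L1 (reflect_in L1 p) = p" and f1: "\<And>p. reflect_in L1 p = p \<longleftrightarrow> p \<in> L1"
    using reflect_in_line L1 unfolding symmetry_axis_def by metis
  obtain g2 where g2: "congruence g2 (reflect_in L2)"
    and i2: "\<And>p. reflect_in L2 (reflect_in L2 p) = p" and f2: "\<And>p. reflect_in L2 p = p \<longleftrightarrow> p \<in> L2"
    using reflect_in_line L2 unfolding symmetry_axis_def by metis
  obtain H where
    H: "\<And>p q. p \<in> set C \<Longrightarrow> q \<in> set C \<Longrightarrow> \<exists>m. q = (H ^^ m) p"
       "\<And>p m. p \<in> set C \<Longrightarrow> (H ^^ m) p \<in> set C"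
       "\<And>g T p m. congruence g T \<Longrightarrow> image_mset T (mset C) = mset C \<Longrightarrow> p \<in> set C \<Longrightarrow>
          (H ^^ m) (T p) = T ((H ^^ m) p)"
    using symmetric_cycle[OF S d n] by blast
  obtain p where p: "p \<in> set C" using n by (cases C) auto
  have in1: "reflect_in L1 p \<in> set C" and in2: "reflect_in L2 p \<in> set C"
    using L1 L2 p unfolding symmetry_axis_def by blast+
  have "reflect_in L1 q = reflect_in L2 q" if "q \<in> set C" for q
    by (rule cycle_involution_unique[where S = "set C" and H = H and p = p])
      (use that p in1 in2 i1 i2 f1 f2 disj[OF L1 p] disj[OF L2 p] H(1,2)
          H(3)[OF g1 symmetry_axis_mset[OF L1 d]] H(3)[OF g2 symmetry_axis_mset[OF L2 d]] in auto)
  then have "affine hull (set C) \<subseteq> {x. reflect_in L1 x = reflect_in L2 x}"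
    using congruence_eq_affine[OF g1 g2] by (intro hull_minimal) auto
  moreover have "affine hull (set C) = UNIV"
  proof -
    have "aff_dim (set C) > 1" using nc by (simp add: collinear_aff_dim)
    moreover have "aff_dim (set C) \<le> 2" using aff_dim_le_DIM[of "set C"] by simp
    ultimately have "aff_dim (set C) = DIM(point)" by simp
    then show ?thesis by (simp only: aff_dim_eq_full)
  qed
  ultimately have "reflect_in L1 x = reflect_in L2 x" for x by blast
  \<comment> \<open>Each axis is recovered as the fixed-point set of its reflection.\<close>
  then have "x \<in> L1 \<longleftrightarrow> x \<in> L2" for x using f1[of x] f2[of x] by simp
  then show False using neq by blast
qed

theorem theorem14:
  fixes n :: nat and C0 :: config
  assumes "n > 2" and "length C0 = n" and "distinct C0"
    and "C0 \<in> C_odot \<or>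
         (\<exists>L. symmetry_axis L (set C0) \<and> L \<inter> set C0 \<noteq> {} \<and> L \<inter> set C0 \<subset> set C0) \<or>
         ((\<exists>L1 L2. L1 \<noteq> L2 \<and> symmetry_axis L1 (set C0) \<and> symmetry_axis L2 (set C0)) \<and>
          \<not> collinear (set C0))"
  shows "\<not> visit_all_solvable 2 C0"
proof -
  have "length C0 > 1" using assms(1,2) by simp
  then show ?thesis
    using assms(3,4) rotation_unsolvable axis_unsolvable two_axes_unsolvable
    unfolding visit_all_solvable_def by metis
qed

end
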